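(* Let $G$ be a group and let $k\in G$ be an element of finite order $n=|k|$. Then $G$ is a $J$-group with constant $k$ if and only if $$\prod_{i=1}^{n} xk^{n-i}=1\qquad\text{for all } x\in G.$$
   Context: $G$ is a $J$-group with constant $k\in G$ if there exists a function $f\colon G\to G$ with $f(xk)=xf(x)$ for all $x\in G$. The (non-commutative) product is taken in order of increasing $i$ from left to right, i.e. it equals $xk^{n-1}xk^{n-2}\cdots xk^2\,xk\,x$. *)

theory Defs
  imports "HOL-Algebra.Multiplicative_Group"
begin

text \<open>Maps \<open>f : G \<rightarrow> G\<close> are HOL functions required to preserve the carrier;
  their values outside the carrier play no role.\<close>

definition J_group :: "('a, 'b) monoid_scheme \<Rightarrow> 'a \<Rightarrow> bool" where
  "J_group G k \<longleftrightarrow> group G \<and> k \<in> carrier G \<and>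
     (\<exists>f \<in> carrier G \<rightarrow> carrier G. \<forall>x \<in> carrier G. f (x \<otimes>\<^bsub>G\<^esub> k) = x \<otimes>\<^bsub>G\<^esub> f x)"

text \<open>The product \<open>a m \<cdot> a (m + 1) \<cdot> \<dots> \<cdot> a n\<close>, with factors in this order from left to
  right (the library's \<open>finprod\<close> is restricted to commutative monoids).\<close>

definition ordered_prod :: "('a, 'b) monoid_scheme \<Rightarrow> (nat \<Rightarrow> 'a) \<Rightarrow> nat \<Rightarrow> nat \<Rightarrow> 'a" where
  "ordered_prod G a m n = foldr (\<otimes>\<^bsub>G\<^esub>) (map a [m..<Suc n]) \<one>\<^bsub>G\<^esub>"

end

theory Submission
  imports Defs
begin

text \<open>
  Write \<open>P m x = x k\<^sup>m\<^sup>-\<^sup>1 \<cdots> x k x\<close> (\<open>coset_prod G k m x\<close>), so that \<open>P (m + 1) x = x k\<^sup>m \<cdot> P m x\<close>. Iterating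
  \<open>f (x k) = x f x\<close> along the coset of \<open>x\<close> modulo the powers of \<open>k\<close> gives
  \<open>f (x k\<^sup>m) = P m x \<cdot> f x\<close> (\<open>J_function_on_coset\<close>). After \<open>n\<close> steps the walk is back
  at \<open>x\<close>, whence \<open>P n x = \<one>\<close>.

  The same formula prescribes \<open>f\<close> in the converse direction: choose one representative
  \<open>r\<close> in each coset and put \<open>f (r k\<^sup>m) = P m r\<close>, that is, normalise \<open>f r = \<one>\<close>. The only
  obstruction is that \<open>m\<close> is determined only modulo \<open>n\<close>, and \<open>P n r = \<one>\<close> says exactly
  that \<open>m \<mapsto> P m r\<close> is periodic with period \<open>n\<close> (\<open>coset_prod_cong_pow\<close>).
\<close>

definition coset_prod :: "('a, 'b) monoid_scheme \<Rightarrow> 'a \<Rightarrow> nat \<Rightarrow> 'a \<Rightarrow> 'a" where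
  "coset_prod G k m x = ordered_prod G (\<lambda>i. x \<otimes>\<^bsub>G\<^esub> k [^]\<^bsub>G\<^esub> (m - i)) 1 m"

lemma coset_prod_0: "coset_prod G k 0 x = \<one>\<^bsub>G\<^esub>"
  by (simp add: coset_prod_def ordered_prod_def)

text \<open>The exponents \<open>m - i\<close> run downwards, so passing from \<open>m\<close> to \<open>m + 1\<close> adds a
  factor on the left and shifts the index of every other factor by one.\<close>

lemma coset_prod_Suc:
  "coset_prod G k (Suc m) x = (x \<otimes>\<^bsub>G\<^esub> k [^]\<^bsub>G\<^esub> m) \<otimes>\<^bsub>G\<^esub> coset_prod G k m x"
proof -
  have "[1..<Suc (Suc m)] = 1 # map Suc [1..<Suc m]"
    by (simp add: upt_conv_Cons map_Suc_upt del: upt_Suc)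
  then show ?thesis
    by (simp add: coset_prod_def ordered_prod_def comp_def del: upt_Suc)
qed

context group
begin

lemma coset_prod_closed:
  assumes "k \<in> carrier G" and "x \<in> carrier G"
  shows "coset_prod G k m x \<in> carrier G"
  using assms by (induction m) (simp_all add: coset_prod_0 coset_prod_Suc)

lemma J_function_on_coset:
  assumes k: "k \<in> carrier G" and f: "f \<in> carrier G \<rightarrow> carrier G"
    and J: "\<And>x. x \<in> carrier G \<Longrightarrow> f (x \<otimes> k) = x \<otimes> f x"
    and x: "x \<in> carrier G"
  shows "f (x \<otimes> k [^] m) = coset_prod G k m x \<otimes> f x"
proof (induction m)
  case 0
  have "f x \<in> carrier G"
    using f x by blast
  then show ?case
    using x by (simp add: coset_prod_0)
next
  case (Suc m)
  have "f x \<in> carrier G"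
    using f x by blast
  moreover have "f (x \<otimes> k [^] Suc m) = (x \<otimes> k [^] m) \<otimes> f (x \<otimes> k [^] m)"
    using J[of "x \<otimes> k [^] m"] k x by (simp add: m_assoc)
  ultimately show ?case
    using Suc.IH k x by (simp add: coset_prod_Suc m_assoc coset_prod_closed)
qed

text \<open>The period \<open>ord k\<close> survives each recursion step because the new factor
  \<open>x k\<^sup>m\<close> depends on \<open>m\<close> only through \<open>k\<^sup>m\<close>.\<close>

lemma coset_prod_add_ord:
  assumes k: "k \<in> carrier G" and x: "x \<in> carrier G"
    and cycle: "coset_prod G k (ord k) x = \<one>"
  shows "coset_prod G k (m + ord k) x = coset_prod G k m x"
proof (induction m)
  case 0
  then show ?case by (simp add: cycle coset_prod_0)
next
  case (Suc m)
  have "k [^] (m + ord k) = k [^] m"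
    using k by (simp flip: nat_pow_mult)
  with Suc.IH show ?case
    by (simp add: coset_prod_Suc)
qed

lemma coset_prod_cong_pow:
  assumes k: "k \<in> carrier G" and x: "x \<in> carrier G"
    and cycle: "coset_prod G k (ord k) x = \<one>"
    and "k [^] i = k [^] (j::nat)"
  shows "coset_prod G k i x = coset_prod G k j x"
  using assms(4)
proof (induction i j rule: linorder_wlog)
  case (le i j)
  have "k [^] i \<otimes> k [^] (j - i) = k [^] j"
    using le(1) k by (simp add: nat_pow_mult)
  then have "k [^] i \<otimes> k [^] (j - i) = k [^] i"
    by (simp only: le(2))
  then have "k [^] (j - i) = \<one>"
    using k by (simp only: l_cancel_one nat_pow_closed)
  then obtain c where "j - i = ord k * c"
    using k by (auto simp: pow_eq_id dvd_def)
  then have j: "j = i + c * ord k"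
    using le(1) by (simp add: mult.commute)
  have "coset_prod G k (i + c * ord k) x = coset_prod G k i x"
  proof (induction c)
    case (Suc c)
    then show ?case
      using coset_prod_add_ord[OF k x cycle, of "i + c * ord k"] by (simp add: ac_simps)
  qed simp
  then show ?case
    by (simp add: j)
next
  case (sym i j)
  then show ?case by simp
qed

lemma J_group_if_cycles_trivial:
  assumes k: "k \<in> carrier G" and ord: "ord k > 0"
    and cycle: "\<And>x. x \<in> carrier G \<Longrightarrow> coset_prod G k (ord k) x = \<one>"
  shows "J_group G k"
proof -
  \<comment> \<open>Choosing from the set \<open>C x\<close>, not from \<open>x\<close> itself, makes \<open>r\<close> constant on cosets.\<close>
  define C where "C x = range (\<lambda>i::nat. x \<otimes> k [^] i)" for x
  define r where "r x = (SOME y. y \<in> C x)" for x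
  define e where "e x = (SOME m::nat. x = r x \<otimes> k [^] m)" for x
  define f where "f x = coset_prod G k (e x) (r x)" for x
  \<comment> \<open>\<open>C x\<close> is built from nonnegative powers only, yet it is the whole coset: by finiteness
    of the order, the inverse of \<open>k\<^sup>i\<close> is itself a nonnegative power of \<open>k\<close>.\<close>
  have inverse_power: "k [^] i \<otimes> k [^] (i * (ord k - 1)) = \<one>" for i :: nat
  proof -
    have "i + i * (ord k - 1) = ord k * i"
      using ord by (cases "ord k") simp_all
    then show ?thesis
      using k by (simp only: nat_pow_mult pow_eq_id dvd_triv_left)
  qed
  have r_closed: "r x \<in> carrier G" and r_e: "r x \<otimes> k [^] e x = x"
    if x: "x \<in> carrier G" for x
  proof -
    have "r x \<in> C x"
      unfolding r_def by (rule someI_ex) (auto simp: C_def)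
    then obtain i :: nat where i: "r x = x \<otimes> k [^] i"
      by (auto simp: C_def)
    then show "r x \<in> carrier G"
      using x k by simp
    have "x = r x \<otimes> k [^] (i * (ord k - 1))"
      unfolding i using x k by (simp add: m_assoc inverse_power del: One_nat_def)
    then show "r x \<otimes> k [^] e x = x"
      unfolding e_def by (rule someI[THEN sym])
  qed
  have r_step: "r (x \<otimes> k) = r x" if x: "x \<in> carrier G" for x
  proof -
    have "C (x \<otimes> k) = C x"
    proof (intro equalityI subsetI)
      fix y assume "y \<in> C (x \<otimes> k)"
      then obtain i :: nat where "y = (x \<otimes> k) \<otimes> k [^] i"
        by (auto simp: C_def)
      then have "y = x \<otimes> k [^] Suc i"
        using x k by (simp only: m_assoc nat_pow_Suc2 nat_pow_closed)
      then show "y \<in> C x"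
        unfolding C_def by (rule range_eqI)
    next
      fix y assume "y \<in> C x"
      then obtain i :: nat where y: "y = x \<otimes> k [^] i"
        by (auto simp: C_def)
      have "k \<otimes> (k [^] (ord k - 1) \<otimes> k [^] i) = k [^] i"
        using inverse_power[of 1] k by (simp flip: m_assoc)
      then have "y = (x \<otimes> k) \<otimes> k [^] (ord k - 1 + i)"
        using x k by (simp add: y m_assoc flip: nat_pow_mult)
      then show "y \<in> C (x \<otimes> k)"
        by (auto simp: C_def)
    qed
    then show ?thesis
      by (simp add: r_def)
  qed
  have "f (x \<otimes> k) = x \<otimes> f x" if x: "x \<in> carrier G" for x
  proof -
    have "r x \<otimes> k [^] e (x \<otimes> k) = x \<otimes> k"
      using r_e[of "x \<otimes> k"] x k by (simp add: r_step)
    also have "\<dots> = r x \<otimes> k [^] Suc (e x)"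
      using r_closed[OF x] k by (simp add: r_e[OF x] flip: m_assoc)
    finally have "k [^] e (x \<otimes> k) = k [^] Suc (e x)"
      using r_closed[OF x] k by (simp only: Units_l_cancel Units_eq nat_pow_closed)
    then have "f (x \<otimes> k) = coset_prod G k (Suc (e x)) (r x)"
      unfolding f_def r_step[OF x]
      by (rule coset_prod_cong_pow[OF k r_closed[OF x] cycle[OF r_closed[OF x]]])
    also have "\<dots> = x \<otimes> f x"
      by (simp add: coset_prod_Suc f_def r_e[OF x])
    finally show ?thesis .
  qed
  moreover have "f \<in> carrier G \<rightarrow> carrier G"
    using k by (auto simp: f_def intro!: coset_prod_closed r_closed)
  ultimately show ?thesis
    unfolding J_group_def using k is_group by blast
qed

end

theorem lemma2p3:
  fixes G (structure) and k :: 'a and n :: nat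
  assumes "group G"
    and "k \<in> carrier G"
    and "n = group.ord G k"
    and "n > 0" \<comment> \<open>\<open>group.ord\<close> is \<open>0\<close> for elements of infinite order\<close>
  shows "J_group G k \<longleftrightarrow>
    (\<forall>x \<in> carrier G. ordered_prod G (\<lambda>i. x \<otimes> k [^] (n - i)) 1 n = \<one>)"
proof -
  interpret group G by fact
  note k = \<open>k \<in> carrier G\<close>
  have "J_group G k \<longleftrightarrow> (\<forall>x \<in> carrier G. coset_prod G k n x = \<one>)"
  proof
    assume "J_group G k"
    then obtain f where f: "f \<in> carrier G \<rightarrow> carrier G"
      and J: "\<And>x. x \<in> carrier G \<Longrightarrow> f (x \<otimes> k) = x \<otimes> f x"
      by (auto simp: J_group_def)
    show "\<forall>x \<in> carrier G. coset_prod G k n x = \<one>"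
    proof
      fix x assume x: "x \<in> carrier G"
      have fx: "f x \<in> carrier G"
        using f x by blast
      have "coset_prod G k n x \<otimes> f x = f (x \<otimes> k [^] n)"
        using J_function_on_coset[OF k f J x] by simp
      also have "\<dots> = \<one> \<otimes> f x"
        using assms(3) k x fx by simp
      finally show "coset_prod G k n x = \<one>"
        using fx k x by (simp only: right_cancel coset_prod_closed one_closed)
    qed
  next
    assume "\<forall>x \<in> carrier G. coset_prod G k n x = \<one>"
    then show "J_group G k"
      using assms(3,4) k by (intro J_group_if_cycles_trivial) auto
  qed
  then show ?thesis
    by (simp only: coset_prod_def)
qed

end
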